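(* Let $A,B\in\mathbb{R}^{n\times n}$ be such that the bimatrix game $(A,B)$ has a unique Nash equilibrium $(E^A,E^B)$, and this equilibrium is completely mixed. Then there exists a bimatrix game $(A',B')$ linearly equivalent to $(A,B)$ such that $$\bar{A'}(q)>\bar{A'}(E^B)\quad\text{and}\quad\bar{B'}(p)>\bar{B'}(E^A)$$ for all $p\in\Sigma^A\setminus\{E^A\}$ and all $q\in\Sigma^B\setminus\{E^B\}$.
   Context: $\Sigma^A\subset\mathbb{R}^{1\times n}$ (row vectors) and $\Sigma^B\subset\mathbb{R}^{n\times1}$ (column vectors) are the simplices of mixed strategies of players A and B. A Nash equilibrium is a pair $(\bar p,\bar q)\in\Sigma^A\times\Sigma^B$ with $\bar pA\bar q=\max_{p\in\Sigma^A}pA\bar q$ and $\bar pB\bar q=\max_{q\in\Sigma^B}\bar pBq$; it is completely mixed if it lies in the (relative) interior of $\Sigma^A\times\Sigma^B$, i.e. all coordinates are positive. For an $n\times n$ game $(A,B)$: $\bar A(q)=\max_{p\in\Sigma^A}pAq=\max_i(Aq)_i$ and $\bar B(p)=\max_{q\in\Sigma^B}pBq=\max_j(pB)_j$. Games $(A,B)$ and $(\tilde A,\tilde B)$ are linearly equivalent if there are $c,d>0$ and reals $c_1,\dots,c_n$, $d_1,\dots,d_n$ with $\tilde a_{ij}=c\,a_{ij}+c_j$ and $\tilde b_{ij}=d\,b_{ij}+d_i$ for all $i,j$. Linearly equivalent games have the same best response correspondences and hence the same Nash equilibria. *)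

theory Defs
  imports "HOL-Analysis.Analysis"
begin

text \<open>
  An \<open>n \<times> n\<close> bimatrix game is a pair of matrices of type \<open>real^'n^'n\<close>, where \<open>A $ i $ j\<close> is the
  entry in row \<open>i\<close> and column \<open>j\<close>; player A chooses rows and player B columns.  The type
  \<open>real^'n\<close> does not distinguish row from column vectors, so one set serves as both simplices
  of mixed strategies.
\<close>

definition mixed_strategies :: "(real^'n) set" where
  "mixed_strategies = {p. (\<forall>i. 0 \<le> p $ i) \<and> (\<Sum>i\<in>UNIV. p $ i) = 1}"

text \<open>The number \<open>p M q\<close> for a row vector \<open>p\<close> and a column vector \<open>q\<close>.\<close>

definition payoff :: "real^'n^'n \<Rightarrow> real^'n \<Rightarrow> real^'n \<Rightarrow> real" where
  "payoff M p q = p \<bullet> (M *v q)"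

text \<open>
  The functions \<open>q \<mapsto> max\<^sub>p p A q\<close> and \<open>p \<mapsto> max\<^sub>q p B q\<close>.  The suprema are attained and equal the
  maximal coordinate of \<open>A q\<close> and \<open>p B\<close>, respectively; see the lemmas below.
\<close>

definition best_payoff_A :: "real^'n^'n \<Rightarrow> real^'n \<Rightarrow> real" where
  "best_payoff_A A q = (SUP p\<in>mixed_strategies. payoff A p q)"

definition best_payoff_B :: "real^'n^'n \<Rightarrow> real^'n \<Rightarrow> real" where
  "best_payoff_B B p = (SUP q\<in>mixed_strategies. payoff B p q)"

definition nash_equilibrium ::
    "real^'n^'n \<Rightarrow> real^'n^'n \<Rightarrow> real^'n \<Rightarrow> real^'n \<Rightarrow> bool" where
  "nash_equilibrium A B p q \<longleftrightarrow>
     p \<in> mixed_strategies \<and> q \<in> mixed_strategies \<and>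
     payoff A p q = best_payoff_A A q \<and> payoff B p q = best_payoff_B B p"

definition completely_mixed :: "real^'n \<Rightarrow> real^'n \<Rightarrow> bool" where
  "completely_mixed p q \<longleftrightarrow>
     p \<in> mixed_strategies \<and> q \<in> mixed_strategies \<and> (\<forall>i. 0 < p $ i) \<and> (\<forall>j. 0 < q $ j)"

definition linearly_equivalent ::
    "real^'n^'n \<Rightarrow> real^'n^'n \<Rightarrow> real^'n^'n \<Rightarrow> real^'n^'n \<Rightarrow> bool" where
  "linearly_equivalent A B A' B' \<longleftrightarrow>
     (\<exists>c d (cs :: 'n \<Rightarrow> real) (ds :: 'n \<Rightarrow> real). 0 < c \<and> 0 < d \<and>
        (\<forall>i j. A' $ i $ j = c * A $ i $ j + cs j) \<and>
        (\<forall>i j. B' $ i $ j = d * B $ i $ j + ds i))"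

lemma SUP_mixed_strategies_inner:
  fixes v :: "real^'n"
  shows "(SUP p\<in>mixed_strategies. p \<bullet> v) = Max (range (($) v))"
    and "\<exists>p\<in>mixed_strategies. p \<bullet> v = Max (range (($) v))"
    and "\<forall>p\<in>mixed_strategies. p \<bullet> v \<le> Max (range (($) v))"
proof -
  show ub: "\<forall>p\<in>mixed_strategies. p \<bullet> v \<le> Max (range (($) v))"
  proof
    fix p :: "real^'n"
    assume p: "p \<in> mixed_strategies"
    have "p \<bullet> v = (\<Sum>i\<in>UNIV. p $ i * v $ i)"
      by (simp add: inner_vec_def)
    also have "\<dots> \<le> (\<Sum>i\<in>UNIV. p $ i * Max (range (($) v)))"
      using p by (intro sum_mono mult_left_mono) (auto simp: mixed_strategies_def)
    also have "\<dots> = Max (range (($) v))"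
      using p by (simp add: mixed_strategies_def flip: sum_distrib_right)
    finally show "p \<bullet> v \<le> Max (range (($) v))" .
  qed
  have "Max (range (($) v)) \<in> range (($) v)"
    by (intro Max_in) auto
  then obtain i where i: "Max (range (($) v)) = v $ i"
    by (rule rangeE)
  have ax: "axis i 1 \<in> mixed_strategies"
    by (simp add: mixed_strategies_def axis_def)
  have eq: "axis i 1 \<bullet> v = Max (range (($) v))"
    using i by (simp add: inner_axis')
  show "\<exists>p\<in>mixed_strategies. p \<bullet> v = Max (range (($) v))"
    using ax eq by blast
  show "(SUP p\<in>mixed_strategies. p \<bullet> v) = Max (range (($) v))"
    using ax eq ub by (intro cSup_eq_maximum) (auto intro: rev_image_eqI)
qed

lemma best_payoff_A_eq_Max: "best_payoff_A A q = Max (range (($) (A *v q)))"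
  unfolding best_payoff_A_def payoff_def by (rule SUP_mixed_strategies_inner)

lemma best_payoff_A_attained: "\<exists>p\<in>mixed_strategies. payoff A p q = best_payoff_A A q"
  unfolding best_payoff_A_eq_Max payoff_def by (rule SUP_mixed_strategies_inner)

lemma payoff_le_best_payoff_A: "p \<in> mixed_strategies \<Longrightarrow> payoff A p q \<le> best_payoff_A A q"
  unfolding best_payoff_A_eq_Max payoff_def using SUP_mixed_strategies_inner(3) by blast

lemma payoff_eq_vector_matrix: "payoff B p q = q \<bullet> (p v* B)"
  by (simp add: payoff_def dot_lmul_matrix inner_commute[of q])

lemma best_payoff_B_eq_Max: "best_payoff_B B p = Max (range (($) (p v* B)))"
  unfolding best_payoff_B_def payoff_eq_vector_matrix by (rule SUP_mixed_strategies_inner)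

lemma best_payoff_B_attained: "\<exists>q\<in>mixed_strategies. payoff B p q = best_payoff_B B p"
  unfolding best_payoff_B_eq_Max payoff_eq_vector_matrix by (rule SUP_mixed_strategies_inner)

lemma payoff_le_best_payoff_B: "q \<in> mixed_strategies \<Longrightarrow> payoff B p q \<le> best_payoff_B B p"
  unfolding best_payoff_B_eq_Max payoff_eq_vector_matrix
  using SUP_mixed_strategies_inner(3) by blast

end

theory Submission
  imports Defs
begin

text \<open>
  Subtract from each column \<open>j\<close> of \<open>A\<close> the constant \<open>(E\<^sup>A A)\<^sub>j\<close>.  For the resulting game \<open>A'\<close> the maximal
  payoff against \<open>q\<close> is \<open>max\<^sub>p p A q - E\<^sup>A A q \<ge> 0\<close>, the regret of player A for playing \<open>E\<^sup>A\<close>.  It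
  vanishes exactly if \<open>E\<^sup>A\<close> is a best response to \<open>q\<close>.  As \<open>E\<^sup>B\<close> is completely mixed, every \<open>q\<close> is a
  best response to \<open>E\<^sup>A\<close>, so in that case \<open>(E\<^sup>A, q)\<close> is an equilibrium and \<open>q = E\<^sup>B\<close> by uniqueness.
  The same argument applies to \<open>B\<close> with the roles of the players exchanged.
\<close>

definition regret_matrix :: "real^'n^'n \<Rightarrow> real^'n \<Rightarrow> real^'n^'n" where
  "regret_matrix A p = (\<chi> i j. A $ i $ j - (p v* A) $ j)"

text \<open>The shift lowers every coordinate of \<open>A *v q\<close> by the same number
  \<open>payoff A p q\<close>; averaging with weights \<open>r\<close> of total 1 preserves
  it.\<close>

lemma payoff_regret_matrix:
  assumes "r \<in> mixed_strategies"
  shows "payoff (regret_matrix A p) r q = payoff A r q - payoff A p q"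
proof -
  have "(regret_matrix A p *v q) $ i = (A *v q) $ i - payoff A p q" for i
    by (simp add: regret_matrix_def matrix_vector_mult_def payoff_eq_vector_matrix
        inner_vec_def algebra_simps sum_subtractf)
  moreover have "(\<Sum>i\<in>UNIV. r $ i * payoff A p q) = payoff A p q"
    using assms by (simp add: mixed_strategies_def flip: sum_distrib_right)
  ultimately show ?thesis
    by (simp add: payoff_def inner_vec_def right_diff_distrib sum_subtractf)
qed

lemma payoff_transpose: "payoff (transpose M) q p = payoff M p q"
  by (simp add: payoff_def dot_lmul_matrix inner_commute[of q])

lemma best_payoff_A_transpose: "best_payoff_A (transpose M) p = best_payoff_B M p"
  by (simp add: best_payoff_A_def best_payoff_B_def payoff_transpose)

lemma best_payoff_B_transpose: "best_payoff_B (transpose M) q = best_payoff_A M q"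
  by (simp add: best_payoff_A_def best_payoff_B_def payoff_transpose)

text \<open>Transposition exchanges the players, so the claim about \<open>B\<close> reduces to the
  one about \<open>A\<close>.\<close>

lemma nash_equilibrium_transpose:
  "nash_equilibrium (transpose B) (transpose A) q p \<longleftrightarrow> nash_equilibrium A B p q"
  by (auto simp: nash_equilibrium_def payoff_transpose best_payoff_A_transpose
      best_payoff_B_transpose)

text \<open>An average with positive weights equals the maximum only if all averaged values do, so
  player B is indifferent between all columns.\<close>

lemma payoff_eq_best_payoff_B_if_completely_mixed:
  assumes "payoff B p q = best_payoff_B B p" "q \<in> mixed_strategies" "\<And>j. 0 < q $ j"
    and "r \<in> mixed_strategies"
  shows "payoff B p r = best_payoff_B B p"
proof -
  define b where "b = best_payoff_B B p"
  have le: "(p v* B) $ j \<le> b" for j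
    by (auto simp: b_def best_payoff_B_eq_Max intro!: Max_ge)
  have avg: "b - payoff B p s = (\<Sum>j\<in>UNIV. s $ j * (b - (p v* B) $ j))"
    if "s \<in> mixed_strategies" for s
    using that by (simp add: payoff_eq_vector_matrix inner_vec_def mixed_strategies_def
        right_diff_distrib sum_subtractf flip: sum_distrib_right)
  have "(\<Sum>j\<in>UNIV. q $ j * (b - (p v* B) $ j)) = 0"
    using avg[OF assms(2)] assms(1) by (simp add: b_def)
  then have "\<forall>j\<in>UNIV. q $ j * (b - (p v* B) $ j) = 0"
    using le assms(3)
    by (subst (asm) sum_nonneg_eq_0_iff) (simp_all add: less_imp_le)
  then have "b - (p v* B) $ j = 0" for j
    using assms(3)[of j] by force
  then show ?thesis
    using avg[OF assms(4)] by (simp add: b_def)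
qed

lemma best_payoff_A_regret_matrix_less:
  assumes nash: "nash_equilibrium A B EA EB"
    and unique: "\<And>p q. nash_equilibrium A B p q \<Longrightarrow> q = EB"
    and mixed: "\<And>j. 0 < EB $ j"
    and q: "q \<in> mixed_strategies" "q \<noteq> EB"
  shows "best_payoff_A (regret_matrix A EA) EB < best_payoff_A (regret_matrix A EA) q"
proof -
  have "payoff B EA q = best_payoff_B B EA"
    using nash mixed q(1) payoff_eq_best_payoff_B_if_completely_mixed
    unfolding nash_equilibrium_def by blast
  then have "payoff A EA q \<noteq> best_payoff_A A q"
    using nash unique[of EA q] q unfolding nash_equilibrium_def by blast
  then have less: "payoff A EA q < best_payoff_A A q"
    using nash payoff_le_best_payoff_A[of EA A q] unfolding nash_equilibrium_def by linarith
  obtain r where r: "r \<in> mixed_strategies"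
      "payoff (regret_matrix A EA) r EB = best_payoff_A (regret_matrix A EA) EB"
    using best_payoff_A_attained by blast
  obtain s where s: "s \<in> mixed_strategies" "payoff A s q = best_payoff_A A q"
    using best_payoff_A_attained by blast
  \<comment> \<open>Zero separates the two sides: against \<open>EB\<close> nothing improves on
    \<open>EA\<close>, whereas \<open>s\<close> strictly does against \<open>q\<close>.\<close>
  have "best_payoff_A (regret_matrix A EA) EB \<le> 0"
    using r payoff_le_best_payoff_A[of r A EB] nash
    by (simp add: payoff_regret_matrix nash_equilibrium_def)
  also have "0 < payoff (regret_matrix A EA) s q"
    using s less by (simp add: payoff_regret_matrix)
  also have "\<dots> \<le> best_payoff_A (regret_matrix A EA) q"
    using s(1) by (rule payoff_le_best_payoff_A)
  finally show ?thesis .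
qed

theorem theorem3p3:
  fixes A B :: "real^'n^'n" and EA EB :: "real^'n"
  assumes "nash_equilibrium A B EA EB"
    and "\<forall>p q. nash_equilibrium A B p q \<longrightarrow> p = EA \<and> q = EB"
    and "completely_mixed EA EB"
  shows "\<exists>A' B'. linearly_equivalent A B A' B' \<and>
           (\<forall>q\<in>mixed_strategies - {EB}. best_payoff_A A' q > best_payoff_A A' EB) \<and>
           (\<forall>p\<in>mixed_strategies - {EA}. best_payoff_B B' p > best_payoff_B B' EA)"
proof (intro exI conjI ballI)
  \<comment> \<open>\<open>?B'\<close> is the regret matrix of the game with exchanged players,
    transposed back; it shifts each row of \<open>B\<close> by a constant.\<close>
  let ?A' = "regret_matrix A EA" and ?B' = "transpose (regret_matrix (transpose B) EB)"
  have A': "\<forall>i j. ?A' $ i $ j = 1 * A $ i $ j + - (EA v* A) $ j"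
    by (simp add: regret_matrix_def)
  have B': "\<forall>i j. ?B' $ i $ j = 1 * B $ i $ j + - (EB v* transpose B) $ i"
    by (simp add: regret_matrix_def transpose_def)
  show "linearly_equivalent A B ?A' ?B'"
    unfolding linearly_equivalent_def
    by (rule exI, rule exI, rule exI[of _ "\<lambda>j. - (EA v* A) $ j"],
        rule exI[of _ "\<lambda>i. - (EB v* transpose B) $ i"])
      (rule conjI[OF zero_less_one conjI[OF zero_less_one conjI[OF A' B']]])
  have mixed: "0 < EA $ i" "0 < EB $ i" for i
    using assms(3) by (simp_all add: completely_mixed_def)
  show "best_payoff_A ?A' EB < best_payoff_A ?A' q" if "q \<in> mixed_strategies - {EB}" for q
    using that assms(2) mixed(2)
    by (intro best_payoff_A_regret_matrix_less[OF assms(1)]) blast+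
  have nash: "nash_equilibrium (transpose B) (transpose A) EB EA"
    using assms(1) by (simp only: nash_equilibrium_transpose)
  have unique: "p = EA" if "nash_equilibrium (transpose B) (transpose A) q p" for p q
    using that assms(2) unfolding nash_equilibrium_transpose by blast
  show "best_payoff_B ?B' EA < best_payoff_B ?B' p" if "p \<in> mixed_strategies - {EA}" for p
    unfolding best_payoff_B_transpose
    using that mixed(1) unique
    by (intro best_payoff_A_regret_matrix_less[OF nash]) blast+
qed

end
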